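(* Let $S$ be a finite set, $f$ a permutation of $S$, and $g:S\to S$ an arbitrary function with $fg=gf$. Denote the set of $f$-cycles of length $i$ by $\mathbf{Z}_i=\bigsqcup_{j=1}^{n_i}Z_{i,j}$, so that $n_a$ is the number of $f$-cycles of length $a$, let $\mathbf{Z}=\bigsqcup_i\mathbf{Z}_i$, and let $\widetilde g:\mathbf{Z}\to\mathbf{Z}$ be the function induced by $g$ on the set of $f$-cycles. Then: (1) any $\widetilde g$-cycle of length $k>1$ permuting $f$-cycles of length $i$ decomposes into $i$ $g$-cycles of length $k$, and any $\widetilde g$-cycle of length $1$ corresponding to an $f$-cycle of length $i$ fixed by $g$ decomposes into $\gcd(i,j)$ $g$-cycles of length $\frac{i}{\gcd(i,j)}$ for some $j$; (2) if $g(Z_{i,j})=Z_{k,l}$ with $k\mid i$, then the restriction of $g$ on $Z_{i,j}\cup Z_{k,l}$ decomposes into a forest of $k$ directed trees of size $\frac{i}{k}+1$; (3) $$|\mathcal{C}(f)|=\prod_{i}\Big(\sum_{d\mid i} n_d\, d\Big)^{n_i}.$$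
   Context: $\mathcal{C}(f)=\{g:S\to S\mid fg=gf\}$. For a permutation $f$ of a finite set, an $f$-cycle is a cycle of its cycle decomposition, fixed points being cycles of length $1$; $Z_{i,j}$ denotes an $f$-cycle of length $i$. A function $g$ commuting with $f$ maps each $f$-cycle $Z$ onto an $f$-cycle $g(Z)$ whose length divides the length of $Z$; $\widetilde g$ is the function $Z\mapsto g(Z)$ on the set of $f$-cycles. A $\widetilde g$-cycle is a directed cycle of the functional graph of $\widetilde g$, and a $g$-cycle is a directed cycle of the functional graph of $g$ (the graph with vertex set $S$ and edges $[s,g(s)]$). A $\widetilde g$-cycle is said to decompose into $g$-cycles in the sense that the union of the vertex sets of the $f$-cycles in it is decomposed into cycles of $g$. By convention $\gcd(i,0)=i$.
   Formalization: In (1), k>1, false as printed (g=(0 1 2 3), f=g²), the g̃-cycle decomposes into gcd(i,j) g-cycles of length k·i/gcd(i,j), where g^k=f^j on it; in (2) the two f-cycles are assumed different and the forest has only the edges [s,g(s)] with s in Z_{i,j}. *)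

theory Defs
  imports "HOL-Library.FuncSet" "HOL-Library.Disjoint_Sets" "HOL-Combinatorics.Orbits"
begin

text \<open>
  A directed cycle of the functional graph of \<open>h\<close> is represented by its vertex set, which
  determines it: the sets \<open>A\<close> with \<^term>\<open>cyclic_on h A\<close> are exactly the (finite) orbits of
  periodic points.  The same notion is used at three levels: for a permutation \<open>f\<close> these are the
  cycles of its cycle decomposition (fixed points included), for a map \<open>g\<close> the \<open>g\<close>-cycles, and
  for the induced map on the set of \<open>f\<close>-cycles the cycles of that map.
\<close>

definition cycles :: "'a set \<Rightarrow> ('a \<Rightarrow> 'a) \<Rightarrow> 'a set set" where
  "cycles S h = {A. A \<subseteq> S \<and> cyclic_on h A}"

definition cycles_of_length :: "'a set \<Rightarrow> ('a \<Rightarrow> 'a) \<Rightarrow> nat \<Rightarrow> 'a set set" where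
  "cycles_of_length S h i = {A \<in> cycles S h. card A = i}"

text \<open>
  A function \<open>S \<rightarrow> S\<close> is represented by a total function that is \<^const>\<open>undefined\<close> outside \<open>S\<close>,
  so that the cardinality of this set counts functions on \<open>S\<close>.
\<close>

definition commutant :: "'a set \<Rightarrow> ('a \<Rightarrow> 'a) \<Rightarrow> ('a \<Rightarrow> 'a) set" where
  "commutant S f = {g \<in> S \<rightarrow>\<^sub>E S. \<forall>x\<in>S. f (g x) = g (f x)}"

definition induced_map :: "('a \<Rightarrow> 'a) \<Rightarrow> 'a set \<Rightarrow> 'a set" where
  "induced_map g Z = g ` Z"

text \<open>
  Going once around a cycle of the induced map of length \<open>k\<close> on \<open>f\<close>-cycles of length \<open>i\<close>, the map
  \<open>g ^^ k\<close> acts as some power \<open>f ^^ j\<close>, which need not be the identity.  The union of these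
  \<open>f\<close>-cycles therefore splits into \<open>gcd i j\<close> \<open>g\<close>-cycles of length \<open>k * (i div gcd i j)\<close>; only for
  \<open>j = 0\<close> (modulo \<open>i\<close>) are these \<open>i\<close> \<open>g\<close>-cycles of length \<open>k\<close>.  Note \<open>gcd i 0 = i\<close>.
\<close>

definition decomposes_into_cycles :: "('a \<Rightarrow> 'a) \<Rightarrow> 'a set \<Rightarrow> nat \<Rightarrow> nat \<Rightarrow> bool" where
  "decomposes_into_cycles g V m l \<longleftrightarrow>
     (\<exists>P. partition_on V P \<and> card P = m \<and> (\<forall>A\<in>P. cyclic_on g A \<and> card A = l))"

text \<open>
  As usual for functional graphs, the edges of a directed tree point towards its root.
\<close>

definition directed_tree :: "'a set \<Rightarrow> ('a \<times> 'a) set \<Rightarrow> bool" where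
  "directed_tree V E \<longleftrightarrow> E \<subseteq> V \<times> V \<and>
     (\<exists>r\<in>V. (\<forall>w. (r, w) \<notin> E) \<and> (\<forall>v\<in>V - {r}. \<exists>!w. (v, w) \<in> E) \<and> (\<forall>v\<in>V. (v, r) \<in> E\<^sup>*))"

definition decomposes_into_trees :: "'a set \<Rightarrow> ('a \<times> 'a) set \<Rightarrow> nat \<Rightarrow> nat \<Rightarrow> bool" where
  "decomposes_into_trees V E m n \<longleftrightarrow>
     (\<exists>P. partition_on V P \<and> card P = m \<and> E \<subseteq> (\<Union>T\<in>P. T \<times> T) \<and>
        (\<forall>T\<in>P. card T = n \<and> directed_tree T (E \<inter> T \<times> T)))"

text \<open>
  For \<open>f\<close>-cycles \<open>Z\<close> and \<open>W = g ` Z\<close>, the restriction of \<open>g\<close> on \<open>Z \<union> W\<close> that forms a forest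
  consists of the edges \<open>[s, g s]\<close> with \<open>s \<in> Z\<close>.  The edges leaving \<open>W\<close> do not belong to it:
  they may stay in \<open>W\<close>, or lead back to \<open>Z\<close>, and then close up directed cycles.
\<close>

definition edges_from :: "('a \<Rightarrow> 'a) \<Rightarrow> 'a set \<Rightarrow> ('a \<times> 'a) set" where
  "edges_from g Z = {(s, g s) | s. s \<in> Z}"

lemma induced_map_cycles:
  assumes "g \<in> commutant S f" "Z \<in> cycles S f"
  shows "induced_map g Z \<in> cycles S f"
proof -
  have Z: "Z \<subseteq> S" "cyclic_on f Z" using assms(2) by (auto simp: cycles_def)
  have "cyclic_on f (g ` Z)"
    by (rule cyclic_on_image[OF Z(2)]) (use assms(1) Z(1) in \<open>auto simp: commutant_def\<close>)
  moreover have "g ` Z \<subseteq> S" using assms(1) Z(1) by (auto simp: commutant_def)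
  ultimately show ?thesis by (simp add: cycles_def induced_map_def)
qed

end

theory Submission
  imports Defs "HOL-Number_Theory.Cong"
begin

text \<open>
  Everything follows from one observation: on a cycle of \<open>f\<close> each point is a power of \<open>f\<close> applied
  to any other point, so a map commuting with \<open>f\<close> is determined on the whole cycle by its value at
  a single point.

  For a cycle of the induced map, of length \<open>k\<close> on \<open>f\<close>-cycles of length \<open>i\<close>, the power \<open>g ^^ k\<close>
  returns every \<open>f\<close>-cycle to itself; at one point \<open>s\<^sub>0\<close> it agrees with some \<open>f ^^ j\<close>, and since all
  points have the form \<open>(g ^^ b) ((f ^^ a) s\<^sub>0)\<close>, it agrees with \<open>f ^^ j\<close> everywhere.  A return
  \<open>(g ^^ n) s = s\<close> forces \<open>n = k * m\<close>, because the \<open>f\<close>-cycle of \<open>s\<close> must return first, and then it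
  means \<open>(f ^^ (j * m)) s = s\<close>, that is \<open>i dvd j * m\<close>, that is \<open>i div gcd i j dvd m\<close>.  Hence all
  points have the same \<open>g\<close>-period \<open>k * (i div gcd i j)\<close>, and counting the \<open>k * i\<close> points gives the
  number of \<open>g\<close>-cycles (\<open>induced_cycle_decomposes\<close>).  The statement about one \<open>f\<close>-cycle mapped
  to itself is the case \<open>k = 1\<close>.

  When \<open>g\<close> maps \<open>Z\<close> onto a different, hence disjoint, cycle \<open>W\<close>, each point of \<open>W\<close> together with
  its preimages in \<open>Z\<close> is a star.  The map \<open>f\<close> carries the preimages of \<open>w\<close> onto those of \<open>f w\<close>,
  so all the stars have the same size (\<open>edges_decompose_into_trees\<close>).

  For the count, choose one representative in each \<open>f\<close>-cycle \<open>Z\<close>.  Its image under \<open>g\<close> may be any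
  point whose \<open>f\<close>-period divides \<open>card Z\<close>, and every choice of such images extends to exactly
  one \<open>g\<close> (\<open>card_commutant_prod\<close>).  The points with period dividing \<open>i\<close> are those
  on cycles of length \<open>d dvd i\<close>, of which there are \<open>d\<close> per cycle (\<open>card_period_dvd\<close>).
\<close>

section \<open>Periods in cycles\<close>

lemma cyclic_on_card_pos: "cyclic_on f A \<Longrightarrow> 0 < card A"
  using finite_cyclic_on[of f A] by (auto simp: card_gt_0_iff cyclic_on_def)

lemma cyclic_on_eqI:
  assumes "cyclic_on f A" "cyclic_on f B" "x \<in> A" "x \<in> B"
  shows "A = B"
  using assms orbit_cyclic_eq3 by metis

lemma cyclic_on_funpow_surj:
  assumes "cyclic_on f A" "x \<in> A" "y \<in> A"
  obtains n where "y = (f ^^ n) x"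
  using assms unfolding cyclic_on_alldef orbit_altdef by blast

lemma cyclic_on_funpow_eq_self_iff:
  assumes "cyclic_on f A" "x \<in> A"
  shows "(f ^^ n) x = x \<longleftrightarrow> card A dvd n"
proof -
  define p where "p = funpow_dist1 f x x"
  have A: "A = orbit f x" and self: "x \<in> orbit f x"
    using assms orbit_cyclic_eq3 by metis+
  have "card A = p"
    unfolding A p_def using orbit_conv_funpow_dist1[OF self] inj_on_funpow_dist1[OF self]
    by (metis card_image card_atLeastLessThan diff_zero)
  moreover have px: "(f ^^ p) x = x"
    unfolding p_def by (rule funpow_dist1_prop[OF self])
  moreover have "p dvd n" if "(f ^^ n) x = x"
  proof (rule ccontr)
    assume "\<not> p dvd n"
    then have "0 < n mod p" by (simp add: dvd_eq_mod_eq_0)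
    moreover have "n mod p < p" by (simp add: p_def)
    moreover have "(f ^^ (n mod p)) x = x" using that px by (simp add: funpow_mod_eq)
    ultimately show False using funpow_dist1_least[of "n mod p" f x x] by (simp add: p_def)
  qed
  moreover have "(f ^^ n) x = x" if "p dvd n"
    using funpow_mod_eq[OF px, of n] that by simp
  ultimately show ?thesis by blast
qed

lemma cyclic_on_funpow_eq_iff:
  assumes "cyclic_on f A" "x \<in> A"
  shows "(f ^^ m) x = (f ^^ n) x \<longleftrightarrow> [m = n] (mod card A)"
proof -
  have *: "(f ^^ m) x = (f ^^ n) x \<longleftrightarrow> [m = n] (mod card A)" if "m \<le> n" for m n
  proof -
    have "(f ^^ n) x = (f ^^ (n - m)) ((f ^^ m) x)"
      using that by (metis add.commute comp_apply funpow_add le_add_diff_inverse)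
    then have "(f ^^ n) x = (f ^^ m) x \<longleftrightarrow> card A dvd n - m"
      using cyclic_on_funpow_eq_self_iff[OF assms(1) cyclic_on_funpow_in[OF assms]] by simp
    then show ?thesis using that by (metis cong_altdef_nat cong_sym)
  qed
  show ?thesis using *[of m n] *[of n m] by (metis cong_sym nat_le_linear)
qed

text \<open>
  This turns the period of \<open>f ^^ j\<close> on an \<open>f\<close>-cycle of length \<open>i\<close> into an explicit number.
\<close>

lemma dvd_mult_iff_div_gcd_dvd:
  fixes i j m :: nat
  assumes "0 < i"
  shows "i dvd j * m \<longleftrightarrow> i div gcd i j dvd m"
proof -
  let ?d = "gcd i j"
  have "i dvd j * m \<longleftrightarrow> i dvd gcd (i * m) (j * m)" by simp
  also have "gcd (i * m) (j * m) = ?d * m" by (simp add: gcd_mult_distrib_nat mult.commute)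
  also have "i dvd ?d * m \<longleftrightarrow> ?d * (i div ?d) dvd ?d * m" by simp
  also have "\<dots> \<longleftrightarrow> i div ?d dvd m" using assms by (intro dvd_times_left_cancel_iff) simp
  finally show ?thesis .
qed

lemma funpow_commute_on:
  assumes "f \<in> V \<rightarrow> V" "g \<in> V \<rightarrow> V" "\<And>x. x \<in> V \<Longrightarrow> f (g x) = g (f x)" "x \<in> V"
  shows "(f ^^ m) ((g ^^ n) x) = (g ^^ n) ((f ^^ m) x)"
proof -
  have gV: "(g ^^ n) x \<in> V" if "x \<in> V" for n x using that assms(2) by (induction n) auto
  have fV: "(f ^^ m) x \<in> V" if "x \<in> V" for m x using that assms(1) by (induction m) auto
  have step: "f ((g ^^ n) x) = (g ^^ n) (f x)" if "x \<in> V" for x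
    using that by (induction n) (use assms(3) gV in auto)
  show ?thesis using assms(4) by (induction m) (use step fV in auto)
qed

section \<open>Cycles of the induced map\<close>

text \<open>
  If all points have the same period \<open>l\<close>, then the orbits are cycles of length \<open>l\<close> that partition
  the set, and their number is forced by its cardinality.
\<close>

lemma decomposes_into_cyclesI:
  assumes "finite V" "g \<in> V \<rightarrow> V" "0 < l"
    and period: "\<And>s n. s \<in> V \<Longrightarrow> (g ^^ n) s = s \<longleftrightarrow> l dvd n"
  shows "decomposes_into_cycles g V (card V div l) l"
proof -
  have self: "s \<in> orbit g s" if "s \<in> V" for s
  proof -
    have "(g ^^ l) s = s" using period[OF that] by simp
    then show ?thesis using \<open>0 < l\<close> unfolding orbit_altdef by force
  qed
  then have cyc: "cyclic_on g (orbit g s)" if "s \<in> V" for s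
    using that by (auto simp: cyclic_on_def)
  have sub: "orbit g s \<subseteq> V" if "s \<in> V" for s
  proof
    fix t assume "t \<in> orbit g s"
    then show "t \<in> V" by induction (use that assms(2) in auto)
  qed
  have len: "card (orbit g s) = l" if "s \<in> V" for s
    using cyclic_on_funpow_eq_self_iff[OF cyc[OF that] self[OF that]] period[OF that]
    by (metis dvd_antisym dvd_refl)
  have part: "partition_on V (orbit g ` V)"
  proof (rule partition_onI)
    show "\<Union> (orbit g ` V) = V" using self sub by blast
    show "{} \<notin> orbit g ` V" using orbit_nonempty by (metis imageE)
    fix p q assume "p \<in> orbit g ` V" "q \<in> orbit g ` V" "p \<noteq> q"
    moreover from this have "cyclic_on g p" "cyclic_on g q" using cyc by blast+
    ultimately show "disjnt p q" using cyclic_on_eqI unfolding disjnt_iff by metis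
  qed
  have "card V = (\<Sum>p\<in>orbit g ` V. card p)"
    using product_partition[OF part] finite_subset[OF sub assms(1)] by blast
  also have "\<dots> = card (orbit g ` V) * l"
    using sum.cong[of "orbit g ` V" "orbit g ` V" card "\<lambda>_. l"] len by fastforce
  finally have "card (orbit g ` V) = card V div l" using \<open>0 < l\<close> by simp
  then show ?thesis
    unfolding decomposes_into_cycles_def using part cyc len by (intro exI[of _ "orbit g ` V"]) auto
qed

lemma funpow_induced_map: "(induced_map g ^^ n) Z = (g ^^ n) ` Z"
  by (induction n) (auto simp: induced_map_def image_image)

text \<open>
  The exponent \<open>j\<close> measures the rotation caused by one trip around the cycle of \<open>f\<close>-cycles.  It is
  read off at one point, transported to all others by commutation, and then determines the common
  period \<open>k * (i div gcd i j)\<close>.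
\<close>

lemma induced_cycle_decomposes:
  assumes g: "g \<in> commutant S f"
    and C: "C \<in> cycles_of_length (cycles S f) (induced_map g) k"
    and len: "C \<subseteq> cycles_of_length S f i"
  shows "\<exists>j. (\<forall>s \<in> \<Union>C. (g ^^ k) s = (f ^^ j) s) \<and>
    decomposes_into_cycles g (\<Union>C) (gcd i j) (k * (i div gcd i j))"
proof -
  define V where "V = \<Union>C"
  have Ccyc: "cyclic_on (induced_map g) C" and k: "card C = k"
    using C by (auto simp: cycles_of_length_def cycles_def)
  have Z: "cyclic_on f Z" "card Z = i" "Z \<subseteq> S" if "Z \<in> C" for Z
    using that len by (auto simp: cycles_of_length_def cycles_def)
  have "0 < k" using cyclic_on_card_pos[OF Ccyc] k by simp
  obtain Z0 where Z0: "Z0 \<in> C" using Ccyc by (auto simp: cyclic_on_def)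
  then obtain s0 where s0: "s0 \<in> Z0" using Z by (auto simp: cyclic_on_def)
  have "0 < i" using cyclic_on_card_pos[OF Z(1)[OF Z0]] Z(2)[OF Z0] by simp
  have fV: "f \<in> V \<rightarrow> V" using cyclic_on_inI[OF Z(1)] by (auto simp: V_def)
  have gV: "g \<in> V \<rightarrow> V" using cyclic_on_inI[OF Ccyc] by (auto simp: V_def induced_map_def)
  have VS: "V \<subseteq> S" using Z by (auto simp: V_def)
  have comm: "(f ^^ m) ((g ^^ n) x) = (g ^^ n) ((f ^^ m) x)" if "x \<in> V" for m n x
    by (rule funpow_commute_on[OF fV gV _ that]) (use g VS in \<open>auto simp: commutant_def\<close>)
  have gpow: "(g ^^ n) ` Z \<in> C" if "Z \<in> C" for n Z
    using cyclic_on_funpow_in[OF Ccyc that, of n] by (simp add: funpow_induced_map)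
  have return: "(g ^^ n) ` Z = Z \<longleftrightarrow> k dvd n" if "Z \<in> C" for n Z
    using cyclic_on_funpow_eq_self_iff[OF Ccyc that, of n] k by (simp add: funpow_induced_map)

  have "(g ^^ k) s0 \<in> Z0" using return[OF Z0, of k] s0 by auto
  then obtain j where j: "(g ^^ k) s0 = (f ^^ j) s0"
    by (rule cyclic_on_funpow_surj[OF Z(1)[OF Z0] s0])
  have gk: "(g ^^ k) s = (f ^^ j) s" if s: "s \<in> V" for s
  proof -
    obtain Z' where Z': "Z' \<in> C" "s \<in> Z'" using s by (auto simp: V_def)
    obtain b where "Z' = (g ^^ b) ` Z0"
      using cyclic_on_funpow_surj[OF Ccyc Z0 Z'(1)] by (metis funpow_induced_map)
    then obtain t where t: "t \<in> Z0" "s = (g ^^ b) t" using Z' by auto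
    obtain a where a: "t = (f ^^ a) s0" using cyclic_on_funpow_surj[OF Z(1)[OF Z0] s0 t(1)] .
    have V: "s0 \<in> V" "t \<in> V" using s0 t Z0 by (auto simp: V_def)
    have "(g ^^ k) t = (f ^^ a) ((g ^^ k) s0)" using comm[OF V(1)] a by simp
    also have "\<dots> = (f ^^ j) t" using j a by (simp flip: funpow_add comp_apply[of "f ^^ _" "f ^^ _"] add: add.commute)
    finally have "(g ^^ b) ((g ^^ k) t) = (f ^^ j) s" using comm[OF V(2)] t(2) by simp
    then show ?thesis using t(2) by (simp flip: funpow_add comp_apply[of "g ^^ _" "g ^^ _"] add: add.commute)
  qed

  define l where "l = k * (i div gcd i j)"
  have "0 < l" using \<open>0 < k\<close> \<open>0 < i\<close> by (simp add: l_def dvd_imp_le div_greater_zero_iff)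
  have period: "(g ^^ n) s = s \<longleftrightarrow> l dvd n" if s: "s \<in> V" for s n
  proof -
    obtain Z' where Z': "Z' \<in> C" "s \<in> Z'" using s by (auto simp: V_def)
    \<comment> \<open>A fixed point of \<open>g ^^ n\<close> makes its \<open>f\<close>-cycle meet its image, and \<open>f\<close>-cycles that meet are equal.\<close>
    have "k dvd n" if "(g ^^ n) s = s"
    proof -
      have "s \<in> (g ^^ n) ` Z'" using that Z'(2) by force
      then have "(g ^^ n) ` Z' = Z'"
        using cyclic_on_eqI[OF Z(1)[OF gpow[OF Z'(1)]] Z(1)[OF Z'(1)]] Z'(2) by blast
      then show ?thesis using return Z'(1) by blast
    qed
    moreover have "(g ^^ (k * m)) s = s \<longleftrightarrow> l dvd k * m" for m
    proof -
      have "(g ^^ (k * m)) s = (f ^^ (j * m)) s"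
      proof (induction m)
        case (Suc m)
        have "(f ^^ (j * m)) s \<in> V"
          using cyclic_on_funpow_in[OF Z(1)[OF Z'(1)] Z'(2)] Z'(1) by (auto simp: V_def)
        then show ?case using Suc gk by (simp add: funpow_add)
      qed simp
      then have "(g ^^ (k * m)) s = s \<longleftrightarrow> i dvd j * m"
        using cyclic_on_funpow_eq_self_iff[OF Z(1)[OF Z'(1)] Z'(2)] Z(2)[OF Z'(1)] by simp
      also have "\<dots> \<longleftrightarrow> i div gcd i j dvd m"
        by (rule dvd_mult_iff_div_gcd_dvd[OF \<open>0 < i\<close>])
      also have "\<dots> \<longleftrightarrow> l dvd k * m" using \<open>0 < k\<close> by (simp add: l_def)
      finally show ?thesis .
    qed
    ultimately show ?thesis unfolding l_def by (metis dvdE dvd_mult_left)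
  qed

  have "finite V"
    unfolding V_def using finite_cyclic_on[OF Ccyc] finite_cyclic_on[OF Z(1)] by blast
  have "card V = (\<Sum>Z\<in>C. card Z)"
    unfolding V_def using finite_cyclic_on[OF Z(1)] cyclic_on_eqI[OF Z(1) Z(1)]
    by (intro card_Union_disjoint) (unfold pairwise_def disjnt_iff, blast+)
  also have "\<dots> = k * i" using Z(2) k by simp
  also have "\<dots> = gcd i j * l" by (simp add: l_def)
  finally have "card V div l = gcd i j" using \<open>0 < l\<close> by simp
  then have "decomposes_into_cycles g V (gcd i j) l"
    using decomposes_into_cyclesI[OF \<open>finite V\<close> gV \<open>0 < l\<close> period] by simp
  then show ?thesis using gk unfolding V_def l_def by blast
qed

section \<open>Trees between two cycles\<close>

lemma star_directed_tree:
  assumes "r \<notin> A"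
  shows "directed_tree (insert r A) {(a, r) | a. a \<in> A}"
  unfolding directed_tree_def using assms by (auto intro!: bexI[of _ r])

text \<open>
  The map \<open>f\<close> is a bijection from the fibre over \<open>v\<close> to the fibre over \<open>f v\<close>; as \<open>f\<close> is transitive
  on \<open>g ` Z\<close>, all fibres have equal size.
\<close>

lemma card_fibre_cyclic:
  assumes Z: "cyclic_on f Z" and comm: "\<And>x. x \<in> Z \<Longrightarrow> f (g x) = g (f x)" and w: "w \<in> g ` Z"
  shows "card {z \<in> Z. g z = w} = card Z div card (g ` Z)"
proof -
  let ?F = "\<lambda>w. {z \<in> Z. g z = w}"
  have fin: "finite Z" by (rule finite_cyclic_on[OF Z])
  have W: "cyclic_on f (g ` Z)" using cyclic_on_image[OF Z] comm by blast
  have fZ: "f ` Z = Z"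
  proof -
    have "cyclic_on f (f ` Z)" by (rule cyclic_on_image[OF Z]) simp
    moreover obtain x where "x \<in> Z" using Z by (auto simp: cyclic_on_def)
    ultimately show ?thesis using cyclic_on_inI[OF Z] cyclic_on_eqI[OF Z] by blast
  qed
  have inj: "inj_on f Z" using fZ fin by (simp add: eq_card_imp_inj_on)
  have inj': "inj_on f (g ` Z)"
  proof (rule eq_card_imp_inj_on)
    have "f ` g ` Z = g ` f ` Z" using comm by (auto simp: image_image)
    then show "card (f ` g ` Z) = card (g ` Z)" using fZ by simp
  qed (use fin in simp)
  have step: "card (?F (f v)) = card (?F v)" if "v \<in> g ` Z" for v
  proof -
    have "?F (f v) = f ` ?F v"
    proof (intro set_eqI iffI)
      fix y assume y: "y \<in> ?F (f v)"
      then obtain x where x: "x \<in> Z" "y = f x" using fZ by blast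
      then have "f (g x) = f v" using y comm by simp
      then have "g x = v" using inj' x that by (auto dest: inj_onD)
      then show "y \<in> f ` ?F v" using x by blast
    qed (use comm cyclic_on_inI[OF Z] in force)
    then show ?thesis using inj by (simp add: card_image inj_on_def)
  qed
  have same: "card (?F v) = card (?F w)" if v: "v \<in> g ` Z" for v
  proof -
    obtain n where n: "v = (f ^^ n) w" using cyclic_on_funpow_surj[OF W w v] .
    have "card (?F ((f ^^ n) w)) = card (?F w)" for n
      by (induction n) (use step cyclic_on_funpow_in[OF W w] in auto)
    then show ?thesis using n by simp
  qed
  have "card Z = (\<Sum>v\<in>g ` Z. card (?F v))"
    using sum.group[OF fin, of "g ` Z" g "\<lambda>_. 1::nat"] fin by simp
  also have "\<dots> = card (g ` Z) * card (?F w)" using same by simp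
  finally show ?thesis using cyclic_on_card_pos[OF W] by simp
qed

text \<open>
  Each tree is a star: a point of \<open>g ` Z\<close> as root, with its fibre as leaves.
\<close>

lemma edges_decompose_into_trees:
  assumes Z: "cyclic_on f Z" and comm: "\<And>x. x \<in> Z \<Longrightarrow> f (g x) = g (f x)"
    and disj: "Z \<inter> g ` Z = {}"
  shows "decomposes_into_trees (Z \<union> g ` Z) (edges_from g Z) (card (g ` Z)) (card Z div card (g ` Z) + 1)"
proof -
  let ?T = "\<lambda>w. insert w {z \<in> Z. g z = w}"
  let ?P = "?T ` g ` Z"
  have fin: "finite Z" by (rule finite_cyclic_on[OF Z])
  have inj: "inj_on ?T (g ` Z)"
  proof (rule inj_onI)
    fix v w assume "v \<in> g ` Z" "w \<in> g ` Z" "?T v = ?T w"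
    then show "v = w" using disj by blast
  qed
  have part: "partition_on (Z \<union> g ` Z) ?P"
  proof (rule partition_onI)
    show "\<Union>?P = Z \<union> g ` Z" by auto
    show "{} \<notin> ?P" by auto
    fix p q assume "p \<in> ?P" "q \<in> ?P" "p \<noteq> q"
    then obtain v w where "v \<in> g ` Z" "w \<in> g ` Z" and pq: "p = ?T v" "q = ?T w"
      by (elim imageE[where f = ?T])
    then have "v \<notin> Z" "w \<notin> Z" using disj by blast+
    moreover have "v \<noteq> w" using \<open>p \<noteq> q\<close> pq by blast
    ultimately show "disjnt p q" unfolding pq by (auto simp: disjnt_iff)
  qed
  have tree: "card (?T w) = card Z div card (g ` Z) + 1"
    "directed_tree (?T w) (edges_from g Z \<inter> ?T w \<times> ?T w)" if w: "w \<in> g ` Z" for w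
  proof -
    have notin: "w \<notin> {z \<in> Z. g z = w}" using w disj by blast
    then show "card (?T w) = card Z div card (g ` Z) + 1"
      using card_fibre_cyclic[OF Z comm w] fin by simp
    have "edges_from g Z \<inter> ?T w \<times> ?T w = {(a, w) | a. a \<in> {z \<in> Z. g z = w}}"
      using w disj unfolding edges_from_def by blast
    then show "directed_tree (?T w) (edges_from g Z \<inter> ?T w \<times> ?T w)"
      using star_directed_tree[OF notin] by simp
  qed
  have "edges_from g Z \<subseteq> (\<Union>T\<in>?P. T \<times> T)" unfolding edges_from_def by blast
  moreover have "card ?P = card (g ` Z)" using card_image[OF inj] .
  ultimately show ?thesis
    unfolding decomposes_into_trees_def using part tree by (intro exI[of _ ?P]) blast
qed

section \<open>Counting the commutant\<close>

lemma finite_cycles: "finite S \<Longrightarrow> finite (cycles S f)"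
  by (rule finite_subset[of _ "Pow S"]) (auto simp: cycles_def)

lemma orbit_in_cycles:
  assumes "finite S" "f permutes S" "x \<in> S"
  shows "orbit f x \<in> cycles S f" "x \<in> orbit f x"
proof -
  show "orbit f x \<in> cycles S f"
    using cyclic_on_orbit[OF assms(2,1)] permutes_orbit_subset[OF assms(2,3)]
    by (simp add: cycles_def)
  have "permutation f" using assms(1,2) by (auto simp: permutation_permutes)
  then show "x \<in> orbit f x" by (rule permutation_self_in_orbit)
qed

lemma card_period_dvd:
  assumes S: "finite S" "f permutes S" and "0 < i"
  shows "card {t \<in> S. card (orbit f t) dvd i} = (\<Sum>d | d dvd i. card (cycles_of_length S f d) * d)"
proof -
  let ?U = "\<lambda>d. \<Union>(cycles_of_length S f d)"
  have cyc: "cyclic_on f Z" "Z \<subseteq> S" "card Z = d" if "Z \<in> cycles_of_length S f d" for Z d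
    using that by (auto simp: cycles_of_length_def cycles_def)
  have orb: "orbit f t \<in> cycles_of_length S f (card (orbit f t))" "t \<in> orbit f t" if "t \<in> S" for t
    using orbit_in_cycles[OF S that] by (auto simp: cycles_of_length_def)
  \<comment> \<open>The period of a point is the length of the cycle that contains it.\<close>
  have "{t \<in> S. card (orbit f t) dvd i} = (\<Union>d\<in>{d. d dvd i}. ?U d)"
  proof (intro set_eqI iffI)
    fix t assume "t \<in> (\<Union>d\<in>{d. d dvd i}. ?U d)"
    then obtain d Z where "d dvd i" "Z \<in> cycles_of_length S f d" "t \<in> Z" by auto
    then show "t \<in> {t \<in> S. card (orbit f t) dvd i}"
      using cyc orbit_cyclic_eq3 by fastforce
  qed (use orb in blast)
  moreover have "card (\<Union>d\<in>{d. d dvd i}. ?U d) = (\<Sum>d | d dvd i. card (?U d))"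
  proof (rule card_UN_disjoint)
    show "finite {d. d dvd i}" using \<open>0 < i\<close> by simp
    show "\<forall>d\<in>{d. d dvd i}. finite (?U d)"
      using cyc(2) by (auto intro: finite_subset[OF _ S(1)])
    have "d = e" if "t \<in> ?U d" "t \<in> ?U e" for t d e
      using that cyc cyclic_on_eqI by (metis UnionE)
    then show "\<forall>d\<in>{d. d dvd i}. \<forall>e\<in>{d. d dvd i}. d \<noteq> e \<longrightarrow> ?U d \<inter> ?U e = {}"
      by blast
  qed
  moreover have "card (?U d) = card (cycles_of_length S f d) * d" for d
  proof -
    have "card (?U d) = (\<Sum>Z\<in>cycles_of_length S f d. card Z)"
      using cyclic_on_eqI[OF cyc(1) cyc(1)] finite_cyclic_on[OF cyc(1)]
      by (intro card_Union_disjoint) (unfold pairwise_def disjnt_iff, blast+)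
    then show ?thesis using cyc(3) by simp
  qed
  ultimately show ?thesis by simp
qed

text \<open>
  Prescribing \<open>r Z \<mapsto> c Z\<close> forces \<open>(f ^^ n) (r Z) \<mapsto> (f ^^ n) (c Z)\<close>.  The exponent \<open>n\<close> is determined
  by the point only modulo \<open>card Z\<close>, and the divisibility hypothesis is what makes the image
  independent of this ambiguity.  Commutation with \<open>f\<close> is then the passage from \<open>n\<close> to \<open>Suc n\<close>.
\<close>

lemma commutant_extend:
  assumes S: "finite S" "f permutes S"
    and r: "\<And>Z. Z \<in> cycles S f \<Longrightarrow> r Z \<in> Z"
    and c: "\<And>Z. Z \<in> cycles S f \<Longrightarrow> c Z \<in> S"
    and dvd: "\<And>Z. Z \<in> cycles S f \<Longrightarrow> card (orbit f (c Z)) dvd card Z"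
  shows "\<exists>g \<in> commutant S f. \<forall>Z \<in> cycles S f. g (r Z) = c Z"
proof -
  define e where "e s = (SOME n. s = (f ^^ n) (r (orbit f s)))" for s
  define g where "g = (\<lambda>s\<in>S. (f ^^ e s) (c (orbit f s)))"
  have g_eq: "g ((f ^^ n) (r Z)) = (f ^^ n) (c Z)" if Z: "Z \<in> cycles S f" for n Z
  proof -
    let ?s = "(f ^^ n) (r Z)"
    have cyc: "cyclic_on f Z" "Z \<subseteq> S" using Z by (auto simp: cycles_def)
    have s: "?s \<in> Z" by (rule cyclic_on_funpow_in[OF cyc(1) r[OF Z]])
    then have orb: "orbit f ?s = Z" by (rule orbit_cyclic_eq3[OF cyc(1)])
    have "?s = (f ^^ e ?s) (r Z)"
      using someI[of "\<lambda>m. ?s = (f ^^ m) (r (orbit f ?s))" n] unfolding e_def orb by blast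
    then have "[n = e ?s] (mod card Z)"
      using cyclic_on_funpow_eq_iff[OF cyc(1) r[OF Z]] by blast
    then have "[n = e ?s] (mod card (orbit f (c Z)))"
      using dvd[OF Z] by (rule cong_dvd_modulus_nat)
    then have "(f ^^ n) (c Z) = (f ^^ e ?s) (c Z)"
      using cyclic_on_funpow_eq_iff[OF cyclic_on_orbit[OF S(2,1)] orbit_in_cycles(2)[OF S c[OF Z]]]
      by blast
    then show ?thesis using s cyc(2) orb by (auto simp: g_def)
  qed
  have repr: "\<exists>n. \<exists>Z \<in> cycles S f. x = (f ^^ n) (r Z)" if "x \<in> S" for x
  proof -
    have Z: "orbit f x \<in> cycles S f" "x \<in> orbit f x" using orbit_in_cycles[OF S that] by auto
    obtain n where "x = (f ^^ n) (r (orbit f x))"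
      using cyclic_on_funpow_surj[OF cyclic_on_orbit[OF S(2,1)] r[OF Z(1)] Z(2)] .
    then show ?thesis using Z(1) by blast
  qed
  have "g \<in> commutant S f"
    unfolding commutant_def
  proof (intro CollectI conjI ballI)
    show "g \<in> S \<rightarrow>\<^sub>E S"
    proof (rule PiE_I)
      fix x assume "x \<in> S"
      then obtain n Z where Z: "Z \<in> cycles S f" "x = (f ^^ n) (r Z)" using repr by blast
      have "(f ^^ n) (c Z) \<in> S"
        using funpow_in_orbit[OF orbit_in_cycles(2)[OF S c[OF Z(1)]]]
          permutes_orbit_subset[OF S(2) c[OF Z(1)]] by blast
      then show "g x \<in> S" using g_eq Z by simp
    qed (simp add: g_def)
    fix x assume "x \<in> S"
    then obtain n Z where Z: "Z \<in> cycles S f" "x = (f ^^ n) (r Z)" using repr by blast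
    then show "f (g x) = g (f x)" using g_eq[of Z n] g_eq[of Z "Suc n"] by simp
  qed
  moreover have "g (r Z) = c Z" if "Z \<in> cycles S f" for Z using g_eq[OF that, of 0] by simp
  ultimately show ?thesis by blast
qed

text \<open>
  Evaluation at one representative per cycle is a bijection from the commutant to the product of the
  sets of admissible images.  It is injective because the representatives reach every point by powers
  of \<open>f\<close>, and surjective by the extension lemma.
\<close>

lemma card_commutant_prod:
  assumes S: "finite S" "f permutes S"
  shows "card (commutant S f) = (\<Prod>Z\<in>cycles S f. card {t \<in> S. card (orbit f t) dvd card Z})"
proof -
  define r :: "'a set \<Rightarrow> 'a" where "r Z = (SOME x. x \<in> Z)" for Z
  let ?T = "\<lambda>Z. {t \<in> S. card (orbit f t) dvd card Z}"
  let ?\<Phi> = "\<lambda>g. \<lambda>Z\<in>cycles S f. g (r Z)"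
  have cyc: "cyclic_on f Z" "Z \<subseteq> S" if "Z \<in> cycles S f" for Z
    using that by (auto simp: cycles_def)
  have r: "r Z \<in> Z" if "Z \<in> cycles S f" for Z
    using cyc(1)[OF that] unfolding r_def by (auto simp: cyclic_on_def intro: someI)
  have fS: "f \<in> S \<rightarrow> S" using permutes_in_image[OF S(2)] by auto
  have pow: "g ((f ^^ n) x) = (f ^^ n) (g x)" if "g \<in> commutant S f" "x \<in> S" for g n x
  proof -
    have "g \<in> S \<rightarrow> S" using that by (auto simp: commutant_def)
    then show ?thesis
      using funpow_commute_on[OF fS, of g x n 1] that by (simp add: commutant_def)
  qed
  have "inj_on ?\<Phi> (commutant S f)"
  proof (rule inj_onI)
    fix g h assume g: "g \<in> commutant S f" and h: "h \<in> commutant S f" and eq: "?\<Phi> g = ?\<Phi> h"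
    show "g = h"
    proof (rule PiE_ext)
      show "g \<in> S \<rightarrow>\<^sub>E S" "h \<in> S \<rightarrow>\<^sub>E S" using g h by (auto simp: commutant_def)
      fix x assume x: "x \<in> S"
      let ?Z = "orbit f x"
      have Z: "?Z \<in> cycles S f" "x \<in> ?Z" using orbit_in_cycles[OF S x] by auto
      obtain n where n: "x = (f ^^ n) (r ?Z)"
        using cyclic_on_funpow_surj[OF cyc(1)[OF Z(1)] r[OF Z(1)] Z(2)] .
      have "g (r ?Z) = h (r ?Z)" using fun_cong[OF eq, of ?Z] Z(1) by simp
      then show "g x = h x"
        using pow[OF g, of "r ?Z" n] pow[OF h, of "r ?Z" n] r[OF Z(1)] cyc(2)[OF Z(1)] n by auto
    qed
  qed
  moreover have "?\<Phi> ` commutant S f = PiE (cycles S f) ?T"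
  proof (intro set_eqI iffI)
    fix c assume "c \<in> ?\<Phi> ` commutant S f"
    then obtain g where g: "g \<in> commutant S f" and c: "c = ?\<Phi> g" by blast
    have "g (r Z) \<in> ?T Z" if Z: "Z \<in> cycles S f" for Z
    proof -
      have x: "r Z \<in> S" using r cyc(2) Z by blast
      then have gx: "g (r Z) \<in> S" using g by (auto simp: commutant_def)
      have "(f ^^ card Z) (r Z) = r Z"
        using cyclic_on_funpow_eq_self_iff[OF cyc(1)[OF Z] r[OF Z]] by simp
      then have "(f ^^ card Z) (g (r Z)) = g (r Z)" using pow[OF g x, of "card Z"] by simp
      then show ?thesis
        using cyclic_on_funpow_eq_self_iff[OF cyclic_on_orbit[OF S(2,1)] orbit_in_cycles(2)[OF S gx]] gx
        by blast
    qed
    then show "c \<in> PiE (cycles S f) ?T" using c by auto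
  next
    fix c assume c: "c \<in> PiE (cycles S f) ?T"
    then obtain g where "g \<in> commutant S f" "\<forall>Z \<in> cycles S f. g (r Z) = c Z"
      using commutant_extend[OF S, of r c] r by (auto simp: PiE_iff)
    moreover from this have "?\<Phi> g = c" using c by (intro PiE_ext[OF _ c]) auto
    ultimately show "c \<in> ?\<Phi> ` commutant S f" by blast
  qed
  ultimately have "card (commutant S f) = card (PiE (cycles S f) ?T)" by (metis card_image)
  then show ?thesis using finite_cycles[OF S(1)] by (simp add: card_PiE)
qed

lemma card_commutant:
  assumes S: "finite S" "f permutes S"
  shows "card (commutant S f) =
    (\<Prod>i = 1..card S. (\<Sum>d | d dvd i. card (cycles_of_length S f d) * d) ^ card (cycles_of_length S f i))"
proof -
  let ?N = "\<lambda>i. \<Sum>d | d dvd i. card (cycles_of_length S f d) * d"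
  have len: "card Z \<in> {1..card S}" if "Z \<in> cycles S f" for Z
    using that cyclic_on_card_pos card_mono[OF S(1), of Z] by (fastforce simp: cycles_def)
  have "card (commutant S f) = (\<Prod>Z\<in>cycles S f. ?N (card Z))"
    unfolding card_commutant_prod[OF S]
  proof (rule prod.cong)
    fix Z assume "Z \<in> cycles S f"
    then have "0 < card Z" using len by fastforce
    then show "card {t \<in> S. card (orbit f t) dvd card Z} = ?N (card Z)"
      by (rule card_period_dvd[OF S])
  qed simp
  also have "\<dots> = (\<Prod>i = 1..card S. \<Prod>Z \<in> {Z \<in> cycles S f. card Z = i}. ?N (card Z))"
    by (rule prod.group[symmetric]) (use finite_cycles[OF S(1)] len in auto)
  also have "\<dots> = (\<Prod>i = 1..card S. ?N i ^ card (cycles_of_length S f i))"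
    by (rule prod.cong) (auto simp: cycles_of_length_def)
  finally show ?thesis .
qed

theorem theorem2p18:
  fixes S :: "'a set" and f :: "'a \<Rightarrow> 'a"
  assumes "finite S" and "f permutes S"
  shows
    "(\<forall>g \<in> commutant S f.
       (\<forall>C i k. C \<in> cycles_of_length (cycles S f) (induced_map g) k \<and> k > 1 \<and>
            C \<subseteq> cycles_of_length S f i \<longrightarrow>
          (\<exists>j::nat. (\<forall>s \<in> \<Union>C. (g ^^ k) s = (f ^^ j) s) \<and>
            decomposes_into_cycles g (\<Union>C) (gcd i j) (k * (i div gcd i j)))) \<and>
       (\<forall>C i. C \<in> cycles_of_length (cycles S f) (induced_map g) 1 \<and>
            C \<subseteq> cycles_of_length S f i \<longrightarrow>
          (\<exists>j::nat. decomposes_into_cycles g (\<Union>C) (gcd i j) (i div gcd i j))) \<and>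
       (\<forall>i k. \<forall>Z \<in> cycles_of_length S f i. \<forall>W \<in> cycles_of_length S f k.
            induced_map g Z = W \<and> k dvd i \<and> Z \<noteq> W \<longrightarrow>
          decomposes_into_trees (Z \<union> W) (edges_from g Z) k (i div k + 1))) \<and>
     card (commutant S f) =
       (\<Prod>i = 1..card S. (\<Sum>d | d dvd i. card (cycles_of_length S f d) * d)
                          ^ card (cycles_of_length S f i))"
proof (intro conjI ballI allI impI)
  fix g C i k
  assume g: "g \<in> commutant S f"
  assume "C \<in> cycles_of_length (cycles S f) (induced_map g) k \<and> k > 1 \<and> C \<subseteq> cycles_of_length S f i"
  then show "\<exists>j::nat. (\<forall>s \<in> \<Union>C. (g ^^ k) s = (f ^^ j) s) \<and>
      decomposes_into_cycles g (\<Union>C) (gcd i j) (k * (i div gcd i j))"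
    using induced_cycle_decomposes[OF g] by blast
next
  fix g C i
  assume g: "g \<in> commutant S f"
  assume "C \<in> cycles_of_length (cycles S f) (induced_map g) 1 \<and> C \<subseteq> cycles_of_length S f i"
  then show "\<exists>j::nat. decomposes_into_cycles g (\<Union>C) (gcd i j) (i div gcd i j)"
    using induced_cycle_decomposes[OF g, of C 1 i] by auto
next
  fix g i k Z W
  assume g: "g \<in> commutant S f" and Z: "Z \<in> cycles_of_length S f i"
    and W: "W \<in> cycles_of_length S f k"
    and *: "induced_map g Z = W \<and> k dvd i \<and> Z \<noteq> W"
  have cyc: "cyclic_on f Z" "cyclic_on f W" "Z \<subseteq> S" "card Z = i" "card W = k"
    using Z W by (auto simp: cycles_of_length_def cycles_def)
  have gZ: "g ` Z = W" using * by (simp add: induced_map_def)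
  have "Z \<inter> g ` Z = {}" using cyclic_on_eqI[OF cyc(1,2)] * gZ by blast
  moreover have "f (g x) = g (f x)" if "x \<in> Z" for x
    using g that cyc(3) by (auto simp: commutant_def)
  ultimately show "decomposes_into_trees (Z \<union> W) (edges_from g Z) k (i div k + 1)"
    using edges_decompose_into_trees[OF cyc(1), of g] gZ cyc(4,5) by simp
next
  show "card (commutant S f) =
       (\<Prod>i = 1..card S. (\<Sum>d | d dvd i. card (cycles_of_length S f d) * d)
                          ^ card (cycles_of_length S f i))"
    by (rule card_commutant[OF assms])
qed

end
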